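(* Let $\mathcal{A}$ be a (randomized) algorithm that solves the wake-up problem with high probability in $f(n)$ rounds in the radio network model with a single channel and no collision detection (that is, for every network size $n$ and every non-empty set of activated nodes, the problem is solved within $f(n)$ rounds with probability at least $1-\frac1n$). Then $f(n)\in\Omega(\log^2 n)$.
   Context: Radio network model (single hop, single channel, no collision detection): there are $n$ nodes with unique ids from $[n]=\{1,\dots,n\}$, every two of which are neighbors. Executions proceed in synchronous rounds. In each round each node either transmits a message or receives. A node $u$ receives a message from $v$ in a round if and only if $u$ is receiving, $v$ is transmitting, and $v$ is the only neighbor of $u$ transmitting in that round; otherwise $u$ receives nothing, and nodes cannot distinguish silence from collision. Wake-up problem: all nodes are initially inactive; at the beginning of the execution an adversary activates an arbitrary non-empty subset of the nodes. Inactive nodes can only listen; active nodes execute an arbitrary randomized algorithm and have no advance knowledge of the identities of the other active nodes. The problem is solved in the first round in which exactly one active node transmits (an active node broadcasts alone). Asymptotics are as $n\to\infty$. *)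

theory Defs
  imports "HOL-Probability.Probability" "HOL-Library.Landau_Symbols"
begin

datatype 'm action = Listen | Transmit 'm

text \<open>
  A randomized algorithm for the radio network model, given for every network size \<open>n\<close> and every
  node id \<open>u\<close>. The private randomness of a node is a single seed drawn from an arbitrary probability
  space (for instance an infinite sequence of coin flips). The action of a node in a round is a
  function of \<open>n\<close>, its id, its seed and the list of its receptions in all previous rounds, oldest
  first; the length of this list is the number of elapsed rounds. The node's own earlier actions
  are determined by the same data, so they are not recorded. A reception of \<open>None\<close> stands
  equally for silence, for a collision, and for a round in which the node itself transmitted.
\<close>

record ('r, 'm) algorithm =
  seed :: "nat \<Rightarrow> nat \<Rightarrow> 'r measure"
  act :: "nat \<Rightarrow> nat \<Rightarrow> 'r \<Rightarrow> 'm option list \<Rightarrow> 'm action"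

text \<open>
  For a countable message type, measurability of the choice of action for each fixed reception
  history makes the whole execution measurable in the seeds.
\<close>

definition randomized_algorithm :: "('r, 'm::countable) algorithm \<Rightarrow> bool" where
  "randomized_algorithm A \<longleftrightarrow>
     (\<forall>n. \<forall>u\<in>{1..n}. prob_space (seed A n u) \<and>
        (\<forall>h. (\<lambda>r. act A n u r h) \<in> measurable (seed A n u) (count_space UNIV)))"

definition neighbors :: "nat \<Rightarrow> nat \<Rightarrow> nat set" where
  "neighbors n u = {1..n} - {u}"

definition receives_from :: "nat \<Rightarrow> (nat \<Rightarrow> 'm action) \<Rightarrow> nat \<Rightarrow> nat \<Rightarrow> 'm \<Rightarrow> bool" where
  "receives_from n a u v m \<longleftrightarrow>
     a u = Listen \<and> v \<in> neighbors n u \<and> a v = Transmit m \<and>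
     (\<forall>w\<in>neighbors n u. a w \<noteq> Listen \<longrightarrow> w = v)"

definition reception :: "nat \<Rightarrow> (nat \<Rightarrow> 'm action) \<Rightarrow> nat \<Rightarrow> 'm option" where
  "reception n a u =
     (if \<exists>v m. receives_from n a u v m then Some (THE m. \<exists>v. receives_from n a u v m) else None)"

text \<open>
  \<open>W\<close> is the set of activated nodes, \<open>\<omega>\<close> assigns each node its seed, and \<open>h\<close> assigns each node its
  reception history.
\<close>

definition round_actions ::
  "('r, 'm) algorithm \<Rightarrow> nat \<Rightarrow> nat set \<Rightarrow> (nat \<Rightarrow> 'r) \<Rightarrow> (nat \<Rightarrow> 'm option list) \<Rightarrow> nat \<Rightarrow> 'm action" where
  "round_actions A n W \<omega> h u = (if u \<in> W then act A n u (\<omega> u) (h u) else Listen)"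

primrec history ::
  "('r, 'm) algorithm \<Rightarrow> nat \<Rightarrow> nat set \<Rightarrow> (nat \<Rightarrow> 'r) \<Rightarrow> nat \<Rightarrow> nat \<Rightarrow> 'm option list" where
  "history A n W \<omega> 0 = (\<lambda>u. [])"
| "history A n W \<omega> (Suc t) =
     (\<lambda>u. history A n W \<omega> t u @ [reception n (round_actions A n W \<omega> (history A n W \<omega> t)) u])"

text \<open>
  Rounds are numbered from 0. An inactive node stays inactive here even after it receives a message;
  such a reception can only happen in or after the first round in which an active node broadcasts
  alone, so this has no influence on when the problem is solved.
\<close>

definition broadcasts_alone :: "('r, 'm) algorithm \<Rightarrow> nat \<Rightarrow> nat set \<Rightarrow> (nat \<Rightarrow> 'r) \<Rightarrow> nat \<Rightarrow> bool" where
  "broadcasts_alone A n W \<omega> t \<longleftrightarrow>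
     (\<exists>!u. u \<in> W \<and> round_actions A n W \<omega> (history A n W \<omega> t) u \<noteq> Listen)"

definition wakeup_solved_within :: "('r, 'm) algorithm \<Rightarrow> nat \<Rightarrow> nat set \<Rightarrow> (nat \<Rightarrow> 'r) \<Rightarrow> nat \<Rightarrow> bool" where
  "wakeup_solved_within A n W \<omega> T \<longleftrightarrow> (\<exists>t<T. broadcasts_alone A n W \<omega> t)"

text \<open>The product measure expresses that the seeds of different nodes are independent.\<close>

definition solves_wakeup_whp :: "('r, 'm) algorithm \<Rightarrow> (nat \<Rightarrow> nat) \<Rightarrow> bool" where
  "solves_wakeup_whp A f \<longleftrightarrow>
     (\<forall>n\<ge>1. \<forall>W. W \<subseteq> {1..n} \<and> W \<noteq> {} \<longrightarrow>
        measure (PiM {1..n} (seed A n))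
          {\<omega> \<in> space (PiM {1..n} (seed A n)). wakeup_solved_within A n W \<omega> (f n)}
        \<ge> 1 - 1 / real n)"

end

theory Submission
  imports Defs "HOL-Real_Asymp.Real_Asymp"
begin

text \<open>
  Before the first lone broadcast every reception is \<open>None\<close>, so a run is governed by the sets \<open>S\<^sub>t\<close>
  of nodes whose seed makes them transmit after \<open>t\<close> silent rounds, and the activated set \<open>W\<close> fails
  iff no \<open>W \<inter> S\<^sub>t\<close> is a singleton. By averaging it suffices to find a distribution of \<open>W\<close>, not
  depending on the \<open>S\<^sub>t\<close>, under which any \<open>c log\<^sup>2 n\<close> fixed sets all avoid singleton intersections
  with probability above \<open>1/n\<close>. Choose a scale \<open>i\<close> among about \<open>(log n)/4\<close> many and activate every
  node independently with probability \<open>p\<^sub>i = 2\<close> to the power \<open>-(i+1)\<close>.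

  For fixed sets, going through the scales upwards, absorb into \<open>U\<^sub>i\<close> every set whose part outside
  the current union has at most \<open>16 * 2 ^ i\<close> elements. At scale \<open>i\<close> let \<open>W\<close> avoid \<open>U\<^sub>i\<close>, and hit each
  remaining set at least twice; the latter events are increasing, hence positively correlated by
  Harris' inequality. The negative logarithm of the probability is at most \<open>card U\<^sub>i / 2 ^ i\<close> plus
  contributions of the remaining sets. Both terms decay geometrically away from the scale at which
  a set is absorbed, so each set costs \<open>O(1)\<close> in total over all scales, and some scale costs only
  a small multiple of \<open>log n\<close>.
\<close>

section \<open>Random subsets and Harris' inequality\<close>

text \<open>The expectation of \<open>f X\<close> when \<open>X\<close> contains each element of \<open>V\<close> independently with probability \<open>p\<close>.\<close>

definition bexp :: "real \<Rightarrow> 'a set \<Rightarrow> ('a set \<Rightarrow> real) \<Rightarrow> real" where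
  "bexp p V f = (\<Sum>X\<in>Pow V. p ^ card X * (1 - p) ^ card (V - X) * f X)"

lemma bexp_empty [simp]: "bexp p {} f = f {}"
  by (simp add: bexp_def)

text \<open>Condition on whether \<open>a\<close> belongs to the random set; the inductions on
  \<open>V\<close> below rest on this.\<close>

lemma bexp_insert:
  assumes "finite V" "a \<notin> V"
  shows "bexp p (insert a V) f = (1 - p) * bexp p V f + p * bexp p V (\<lambda>X. f (insert a X))"
proof -
  have disj: "Pow V \<inter> insert a ` Pow V = {}"
    using assms by auto
  have inj: "inj_on (insert a) (Pow V)"
    using assms by (auto simp: inj_on_def)
  have 1: "p ^ card X * (1 - p) ^ card (insert a V - X) * f X
      = (1 - p) * (p ^ card X * (1 - p) ^ card (V - X) * f X)" if "X \<in> Pow V" for X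
  proof -
    have "insert a V - X = insert a (V - X)" "a \<notin> V - X"
      using that assms by auto
    then show ?thesis using assms by simp
  qed
  have 2: "p ^ card (insert a X) * (1 - p) ^ card (insert a V - insert a X) * f (insert a X)
      = p * (p ^ card X * (1 - p) ^ card (V - X) * f (insert a X))" if "X \<in> Pow V" for X
  proof -
    have "insert a V - insert a X = V - X" "a \<notin> X" "finite X"
      using that assms by (auto intro: finite_subset)
    then show ?thesis by simp
  qed
  have "bexp p (insert a V) f
      = (\<Sum>X\<in>Pow V. p ^ card X * (1 - p) ^ card (insert a V - X) * f X)
      + (\<Sum>X\<in>Pow V. p ^ card (insert a X) * (1 - p) ^ card (insert a V - insert a X) * f (insert a X))"
    unfolding bexp_def Pow_insert
    using assms disj by (subst sum.union_disjoint) (auto simp only: sum.reindex [OF inj] o_def finite_Pow_iff intro: finite_imageI)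
  then show ?thesis
    by (simp only: bexp_def sum_distrib_left 1 2 cong: sum.cong)
qed

lemma bexp_mono:
  assumes "0 \<le> p" "p \<le> 1" "\<And>X. X \<subseteq> V \<Longrightarrow> f X \<le> g X"
  shows "bexp p V f \<le> bexp p V g"
  unfolding bexp_def using assms by (intro sum_mono mult_left_mono) auto

lemma bexp_const: "finite V \<Longrightarrow> bexp p V (\<lambda>_. c) = c"
  by (induction V rule: finite_induct) (auto simp: bexp_insert algebra_simps)

lemma bexp_diff: "bexp p V (\<lambda>X. f X - g X) = bexp p V f - bexp p V g"
  by (simp add: bexp_def right_diff_distrib sum_subtractf)

text \<open>Elements outside \<open>R\<close> integrate out, because their two weights
  \<open>1 - p\<close> and \<open>p\<close> add up to 1.\<close>

lemma bexp_marginal: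
  assumes "finite V"
  shows "bexp p V (\<lambda>X. f (X \<inter> R)) = bexp p (V \<inter> R) f"
  using assms
proof (induction V arbitrary: f rule: finite_induct)
  case (insert a V)
  show ?case
  proof (cases "a \<in> R")
    case True
    then show ?thesis
      using insert.hyps insert.IH[of f] insert.IH[of "\<lambda>X. f (insert a X)"]
      by (simp add: bexp_insert)
  next
    case False
    then show ?thesis
      using insert.hyps insert.IH[of f] by (simp add: bexp_insert algebra_simps)
  qed
qed simp

lemma bexp_Harris:
  assumes "finite V" "0 \<le> p" "p \<le> 1" "mono f" "mono g"
  shows "bexp p V f * bexp p V g \<le> bexp p V (\<lambda>X. f X * g X)"
  using assms(1,4,5)
proof (induction V arbitrary: f g rule: finite_induct)
  case (insert a V)
  define f' g' where "f' = (\<lambda>X. f (insert a X))" and "g' = (\<lambda>X. g (insert a X))"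
  have m: "mono f'" "mono g'"
    using insert.prems by (auto simp: f'_def g'_def intro!: monoI elim!: monoD)
  define x x' y y' where "x = bexp p V f" and "x' = bexp p V f'"
    and "y = bexp p V g" and "y' = bexp p V g'"
  have "x \<le> x'" "y \<le> y'"
    unfolding x_def x'_def y_def y'_def f'_def g'_def
    using assms(2,3)
    by (auto intro!: bexp_mono monoD[OF insert.prems(1)] monoD[OF insert.prems(2)])
  \<comment> \<open>The covariance, over the single coin for \<open>a\<close>, of two conditional
    means that rise together. It is exactly the gap in the next inequality.\<close>
  then have "0 \<le> p * (1 - p) * ((x' - x) * (y' - y))"
    using assms(2,3) by simp
  then have "((1 - p) * x + p * x') * ((1 - p) * y + p * y') \<le> (1 - p) * (x * y) + p * (x' * y')"
    by (simp add: algebra_simps)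
  also have "\<dots> \<le> (1 - p) * bexp p V (\<lambda>X. f X * g X) + p * bexp p V (\<lambda>X. f' X * g' X)"
    unfolding x_def x'_def y_def y'_def using assms(2,3) insert.IH m insert.prems
    by (intro add_mono mult_left_mono) auto
  finally show ?case
    using insert.hyps by (simp add: bexp_insert f'_def g'_def x_def x'_def y_def y'_def)
qed simp

text \<open>Nonnegativity keeps the partial products monotone, so that the inequality for two
  functions can be iterated.\<close>

lemma bexp_Harris_prod:
  fixes f :: "'i \<Rightarrow> 'a set \<Rightarrow> real"
  assumes "finite I" "finite V" "0 \<le> p" "p \<le> 1"
    and "\<And>i. i \<in> I \<Longrightarrow> mono (f i)" and "\<And>i X. i \<in> I \<Longrightarrow> 0 \<le> f i X"
  shows "(\<Prod>i\<in>I. bexp p V (f i)) \<le> bexp p V (\<lambda>X. \<Prod>i\<in>I. f i X)"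
  using assms(1,5,6)
proof (induction I rule: finite_induct)
  case empty
  then show ?case using assms by (simp add: bexp_const)
next
  case (insert j I)
  have nonneg: "0 \<le> bexp p V (f j)"
    using bexp_mono[of p V "\<lambda>_. 0" "f j"] insert.prems assms by (simp add: bexp_const)
  have mono: "mono (\<lambda>X. \<Prod>i\<in>I. f i X)"
    using insert.prems by (intro monoI prod_mono) (auto simp: mono_def)
  have "(\<Prod>i\<in>insert j I. bexp p V (f i)) = bexp p V (f j) * (\<Prod>i\<in>I. bexp p V (f i))"
    using insert.hyps by simp
  also have "\<dots> \<le> bexp p V (f j) * bexp p V (\<lambda>X. \<Prod>i\<in>I. f i X)"
    using nonneg insert.IH insert.prems by (intro mult_left_mono) auto
  also have "\<dots> \<le> bexp p V (\<lambda>X. f j X * (\<Prod>i\<in>I. f i X))"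
    using insert.prems mono assms by (intro bexp_Harris) auto
  finally show ?case using insert.hyps by simp
qed

section \<open>Probabilities of avoiding a set and of hitting it twice\<close>

lemma bexp_card_eq_0:
  assumes "finite R"
  shows "bexp p R (\<lambda>X. of_bool (card X = 0)) = (1 - p) ^ card R"
proof -
  have "bexp p R (\<lambda>X. of_bool (X = {})) = (1 - p) ^ card R"
    using assms by (induction R rule: finite_induct) (auto simp: bexp_insert bexp_const)
  moreover have "bexp p R (\<lambda>X. of_bool (card X = 0)) = bexp p R (\<lambda>X. of_bool (X = {}))"
    unfolding bexp_def using assms by (intro sum.cong) (auto dest: finite_subset)
  ultimately show ?thesis by simp
qed

lemma bexp_card_le_1:
  assumes "finite R"
  shows "bexp p R (\<lambda>X. of_bool (card X \<le> 1))
    = (1 - p) ^ card R + real (card R) * p * (1 - p) ^ (card R - 1)"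
  using assms
proof (induction R rule: finite_induct)
  case (insert a R)
  have hit: "bexp p R (\<lambda>X. of_bool (card (insert a X) \<le> 1)) = (1 - p) ^ card R"
    unfolding bexp_card_eq_0[OF insert.hyps(1), symmetric] bexp_def
  proof (intro sum.cong refl)
    fix X assume "X \<in> Pow R"
    then have "finite X" "a \<notin> X"
      using insert.hyps by (auto intro: finite_subset)
    then show "p ^ card X * (1 - p) ^ card (R - X) * of_bool (card (insert a X) \<le> 1)
        = p ^ card X * (1 - p) ^ card (R - X) * of_bool (card X = 0)"
      by simp
  qed
  then show ?case
    \<comment> \<open>The exponent \<open>card R - 1\<close> is truncated for empty
      \<open>R\<close>, where the factor \<open>card R\<close> vanishes.\<close>
    by (cases "card R")
      (simp_all only: bexp_insert[OF insert.hyps] insert.IH hit card_insert_disjoint[OF insert.hyps],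
        simp_all add: algebra_simps)
qed simp

text \<open>Turns factors \<open>1 - x\<close> into exponentials, so that the costs of different
  events add up.\<close>

lemma exp_le_one_minus:
  fixes x :: real
  assumes "0 \<le> x" "x \<le> 1 / 2"
  shows "exp (- 2 * x) \<le> 1 - x"
proof -
  have "x * (2 * x) \<le> x * 1"
    using assms by (intro mult_left_mono) auto
  then have "- 2 * x \<le> ln (1 - x)"
    using ln_one_minus_pos_lower_bound[OF assms] by (simp add: power2_eq_square)
  then have "exp (- 2 * x) \<le> exp (ln (1 - x))" by simp
  then show ?thesis using assms by simp
qed

text \<open>With \<open>z = p * (card R - 1)\<close> the probability of at most one hit is exactly
  \<open>(1 - p) ^ (card R - 1) * (1 + z)\<close>. This is at most
  \<open>exp (- z) * (1 + z)\<close>, hence at most \<open>2 / z\<close>. Such slow decay suffices,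
  as it still sums geometrically over the scales.\<close>

lemma bexp_two_hits:
  assumes "finite V" "R \<subseteq> V" "0 < p" "p \<le> 1" "p * (real (card R) - 1) \<ge> 4"
  shows "exp (- 4 / (p * (real (card R) - 1))) \<le> bexp p V (\<lambda>X. of_bool (2 \<le> card (X \<inter> R)))"
proof -
  define z where "z = p * (real (card R) - 1)"
  have z: "z \<ge> 4" using assms z_def by simp
  have R: "finite R" using assms finite_subset by blast
  obtain k where k: "card R = Suc k"
  proof (cases "card R")
    case 0
    then show ?thesis using z assms by (simp add: z_def)
  qed auto
  have zk: "z = p * real k" by (simp add: z_def k)
  have "bexp p V (\<lambda>X. of_bool (2 \<le> card (X \<inter> R))) = bexp p R (\<lambda>X. of_bool (2 \<le> card X))"
    using bexp_marginal[OF assms(1), of p "\<lambda>X. of_bool (2 \<le> card X)" R] assms(2)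
    by (simp add: Int_absorb1)
  also have "\<dots> = bexp p R (\<lambda>X. 1 - of_bool (card X \<le> 1))"
    by (rule arg_cong[where f = "bexp p R"]) (auto simp: fun_eq_iff)
  also have "\<dots> = 1 - ((1 - p) ^ Suc k + real (Suc k) * p * (1 - p) ^ k)"
    using bexp_card_le_1[OF R, of p] R by (simp only: bexp_diff bexp_const k) simp
  also have "\<dots> = 1 - (1 - p) ^ k * (1 + z)"
    by (simp add: zk algebra_simps)
  finally have eq: "bexp p V (\<lambda>X. of_bool (2 \<le> card (X \<inter> R))) = 1 - (1 - p) ^ k * (1 + z)" .
  have "(1 - p) ^ k \<le> exp (- p) ^ k"
    using assms exp_ge_add_one_self[of "- p"] by (intro power_mono) auto
  also have "\<dots> = exp (- z)"
    by (simp add: exp_of_nat_mult [symmetric] zk mult.commute)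
  finally have "(1 - p) ^ k * (1 + z) \<le> exp (- z) * (1 + z)"
    using z by (intro mult_right_mono) auto
  also have "\<dots> = (1 + z) / exp z"
    by (simp add: exp_minus field_simps)
  also have "\<dots> \<le> (1 + z) / (1 + z + z\<^sup>2 / 2)"
  proof (rule divide_left_mono)
    show "1 + z + z\<^sup>2 / 2 \<le> exp z"
      using exp_lower_Taylor_quadratic[of z] z by simp
  qed (use z in \<open>auto intro!: mult_pos_pos add_pos_nonneg\<close>)
  also have "\<dots> \<le> 2 / z"
  proof -
    have "0 < 1 + z + z\<^sup>2 / 2" using z by (intro add_pos_nonneg) auto
    then show ?thesis
      using z by (simp add: divide_simps) (simp add: algebra_simps power2_eq_square)
  qed
  finally have "1 - 2 / z \<le> bexp p V (\<lambda>X. of_bool (2 \<le> card (X \<inter> R)))"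
    unfolding eq by simp
  \<comment> \<open>\<open>z >= 4\<close> puts \<open>2 / z\<close> in the range up to
    \<open>1 / 2\<close> where the exponential bound holds.\<close>
  moreover have "exp (- 2 * (2 / z)) \<le> 1 - 2 / z"
    using z by (intro exp_le_one_minus) auto
  ultimately show ?thesis by (simp add: z_def)
qed

text \<open>Only the outcomes disjoint from \<open>U\<close> are kept; on these each element of
  \<open>U\<close> contributes a factor \<open>1 - p\<close>.\<close>

lemma bexp_avoid:
  assumes "finite V" "U \<subseteq> V" "0 \<le> p" "p \<le> 1" "\<And>X. X \<subseteq> V \<Longrightarrow> 0 \<le> f X"
  shows "(1 - p) ^ card U * bexp p (V - U) f \<le> bexp p V f"
proof -
  have "(1 - p) ^ card U * bexp p (V - U) f
      = (\<Sum>X\<in>Pow (V - U). p ^ card X * (1 - p) ^ card (V - X) * f X)"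
    unfolding bexp_def sum_distrib_left
  proof (intro sum.cong refl)
    fix X assume X: "X \<in> Pow (V - U)"
    have "card (V - X) = card (U \<union> (V - U - X))"
      using X assms by (intro arg_cong[where f = card]) auto
    also have "\<dots> = card U + card (V - U - X)"
      using assms by (intro card_Un_disjoint) (auto intro: finite_subset)
    finally show "(1 - p) ^ card U * (p ^ card X * (1 - p) ^ card (V - U - X) * f X)
        = p ^ card X * (1 - p) ^ card (V - X) * f X"
      by (simp add: power_add)
  qed
  also have "\<dots> \<le> bexp p V f"
    unfolding bexp_def using assms by (intro sum_mono2) auto
  finally show ?thesis .
qed

section \<open>Absorbing nearly covered sets\<close>

text \<open>Take \<open>G\<close> maximal subject to the size bound. A set with at most
  \<open>m\<close> uncovered elements could still be added without breaking the bound.\<close>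

lemma absorb_step:
  assumes "finite F" "H \<subseteq> F"
  shows "\<exists>G. H \<subseteq> G \<and> G \<subseteq> F \<and> card (\<Union>G) \<le> card (\<Union>H) + m * card (G - H)
    \<and> (\<forall>S\<in>F - G. m < card (S - \<Union>G))"
proof -
  define P where "P G \<longleftrightarrow> H \<subseteq> G \<and> G \<subseteq> F \<and> card (\<Union>G) \<le> card (\<Union>H) + m * card (G - H)" for G
  have "finite (Collect P)"
    by (rule finite_subset[of _ "Pow F"]) (use assms in \<open>auto simp: P_def\<close>)
  moreover have "H \<in> Collect P" using assms by (simp add: P_def)
  ultimately obtain G where G: "P G" and max: "\<And>G'. P G' \<Longrightarrow> G \<subseteq> G' \<Longrightarrow> G = G'"
    using finite_has_maximal[of "Collect P"] by blast
  have "m < card (S - \<Union>G)" if S: "S \<in> F - G" for S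
  proof (rule ccontr)
    assume "\<not> m < card (S - \<Union>G)"
    moreover have "card (\<Union>(insert S G)) \<le> card (\<Union>G) + card (S - \<Union>G)"
    proof -
      have "\<Union>(insert S G) = \<Union>G \<union> (S - \<Union>G)" by auto
      then show ?thesis by (metis card_Un_le)
    qed
    moreover have "card (insert S G - H) = Suc (card (G - H))"
    proof -
      have "insert S G - H = insert S (G - H)" using S G by (auto simp: P_def)
      moreover have "finite (G - H)" using G assms by (auto simp: P_def intro: finite_subset)
      ultimately show ?thesis using S by simp
    qed
    ultimately have "P (insert S G)"
      using S G by (auto simp: P_def)
    then show False using max[of "insert S G"] S by auto
  qed
  then show ?thesis using G by (auto simp: P_def)
qed

text \<open>A set absorbed at stage \<open>j\<close> enlarges the union by at most
  \<open>16 * 2 ^ j\<close>, which accounts for at most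
  \<open>16 * (1 + 1/2 + 1/4 + ...) = 32\<close> in the weighted sum from stage \<open>j\<close>
  on.\<close>

lemma absorb_chain:
  assumes "finite F"
  obtains G :: "nat \<Rightarrow> 'a set set"
  where "\<And>i. G i \<subseteq> F" "\<And>i. G i \<subseteq> G (Suc i)"
    "\<And>i S. S \<in> F - G i \<Longrightarrow> 16 * 2 ^ i < card (S - \<Union>(G i))"
    "\<And>k. (\<Sum>i\<le>k. card (\<Union>(G i)) / 2 ^ i) \<le> 32 * real (card F)"
proof -
  \<comment> \<open>Only \<open>P 0\<close> is known of the first family, so its size bound is built
    into \<open>P\<close>.\<close>
  define P where "P i G \<longleftrightarrow> G \<subseteq> F \<and> (\<forall>S\<in>F - G. 16 * 2 ^ i < card (S - \<Union>G))
      \<and> (i = 0 \<longrightarrow> card (\<Union>G) \<le> 16 * card G)" for i :: nat and G :: "'a set set"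
  define Q where "Q i H G \<longleftrightarrow> H \<subseteq> G
      \<and> card (\<Union>G) \<le> card (\<Union>H) + 16 * 2 ^ Suc i * card (G - H)" for i :: nat and H G :: "'a set set"
  have "\<exists>G. \<forall>i. P i (G i) \<and> Q i (G i) (G (Suc i))"
  proof (rule dependent_nat_choice)
    obtain G where "G \<subseteq> F" "card (\<Union>G) \<le> 16 * card G" "\<forall>S\<in>F - G. 16 < card (S - \<Union>G)"
      using absorb_step[OF assms empty_subsetI, of 16] by auto
    then show "\<exists>G. P 0 G" by (intro exI[of _ G]) (auto simp: P_def)
  next
    fix H i assume "P i H"
    then have "H \<subseteq> F" by (simp add: P_def)
    then have "\<exists>G. H \<subseteq> G \<and> G \<subseteq> F \<and> card (\<Union>G) \<le> card (\<Union>H) + 16 * 2 ^ Suc i * card (G - H)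
        \<and> (\<forall>S\<in>F - G. 16 * 2 ^ Suc i < card (S - \<Union>G))"
      by (rule absorb_step[OF assms])
    then show "\<exists>G. P (Suc i) G \<and> Q i H G"
      unfolding P_def Q_def by (elim ex_forward) simp
  qed
  then obtain G where G: "\<And>i. P i (G i)" "\<And>i. Q i (G i) (G (Suc i))" by blast
  have fin: "finite (G i)" for i
    using G(1)[of i] assms by (auto simp: P_def intro: finite_subset)
  \<comment> \<open>The extra last term makes the induction go through, as it halves in each step.\<close>
  have sums: "(\<Sum>i\<le>k. card (\<Union>(G i)) / 2 ^ i) + card (\<Union>(G k)) / 2 ^ k \<le> 32 * real (card (G k))" for k
  proof (induction k)
    case 0
    have "card (\<Union>(G 0)) \<le> 16 * card (G 0)" using G(1)[of 0] by (simp add: P_def)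
    then have "real (card (\<Union>(G 0))) \<le> 16 * real (card (G 0))" by linarith
    then show ?case by simp
  next
    case (Suc k)
    define d where "d = card (G (Suc k) - G k)"
    have sub: "G k \<subseteq> G (Suc k)" using G(2) by (simp add: Q_def)
    have d: "real (card (G (Suc k))) = real (card (G k)) + real d"
      using card_Diff_subset[OF fin sub] card_mono[OF fin sub] by (simp add: d_def)
    have "card (\<Union>(G (Suc k))) \<le> card (\<Union>(G k)) + 16 * 2 ^ Suc k * d"
      using G(2)[of k] by (simp add: Q_def d_def)
    then have "real (card (\<Union>(G (Suc k)))) \<le> real (card (\<Union>(G k)) + 16 * 2 ^ Suc k * d)"
      by (rule of_nat_mono)
    then have "real (card (\<Union>(G (Suc k)))) / 2 ^ Suc k
        \<le> real (card (\<Union>(G k)) + 16 * 2 ^ Suc k * d) / 2 ^ Suc k"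
      by (rule divide_right_mono) simp
    also have "\<dots> = card (\<Union>(G k)) / 2 ^ k / 2 + 16 * real d"
      by (simp add: field_simps)
    \<comment> \<open>The new summand occurs twice in the claim: its halved old part uses up the
      extra term of the induction hypothesis, and each new set costs
      \<open>2 * 16 = 32\<close>.\<close>
    finally show ?case using Suc d by simp
  qed
  have "(\<Sum>i\<le>k. card (\<Union>(G i)) / 2 ^ i) \<le> 32 * real (card F)" for k
  proof -
    have "card (G k) \<le> card F"
      using G(1)[of k] assms by (auto simp: P_def intro: card_mono)
    moreover have "0 \<le> card (\<Union>(G k)) / (2 ^ k :: real)" by simp
    ultimately show ?thesis using sums[of k] by linarith
  qed
  then show thesis using that[of G] G by (auto simp: P_def Q_def)
qed

section \<open>Choosing a scale of low cost\<close>

text \<open>Here \<open>I\<close> stands for the scales at which one fixed set is unabsorbed, and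
  \<open>\<rho>\<close> for its residual size less one. The lower bound at the largest scale of
  \<open>I\<close> carries over to all smaller ones, so the terms are dominated by a geometric
  series ending in \<open>1 / 2\<close>.\<close>

lemma sum_hit_cost_le:
  fixes \<rho> :: "nat \<Rightarrow> real"
  assumes "finite I" "\<And>i j. i \<in> I \<Longrightarrow> j \<in> I \<Longrightarrow> i \<le> j \<Longrightarrow> \<rho> j \<le> \<rho> i"
    and "\<And>i. i \<in> I \<Longrightarrow> 16 * 2 ^ i \<le> \<rho> i"
  shows "(\<Sum>i\<in>I. 8 * 2 ^ i / \<rho> i) \<le> 1"
proof (cases "I = {}")
  case False
  define k where "k = Max I"
  have k: "k \<in> I" "\<And>i. i \<in> I \<Longrightarrow> i \<le> k"
    using False assms(1) by (auto simp: k_def)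
  have "(\<Sum>i\<in>I. 8 * 2 ^ i / \<rho> i) \<le> (\<Sum>i\<in>I. 2 ^ i / (2 * 2 ^ k))"
  proof (rule sum_mono)
    fix i assume i: "i \<in> I"
    have "16 * 2 ^ k \<le> \<rho> i"
      using assms(2)[of i k] assms(3)[of k] k i by force
    then have "8 * 2 ^ i / \<rho> i \<le> 8 * 2 ^ i / (16 * 2 ^ k)"
      by (intro divide_left_mono mult_pos_pos) (auto intro: less_le_trans[of 0 "16 * 2 ^ k"])
    then show "8 * 2 ^ i / \<rho> i \<le> 2 ^ i / (2 * 2 ^ k)" by simp
  qed
  also have "\<dots> \<le> (\<Sum>i\<le>k. 2 ^ i / (2 * 2 ^ k))"
    using k by (intro sum_mono2) auto
  also have "\<dots> = (\<Sum>i<Suc k. 2 ^ i) / (2 * 2 ^ k :: real)"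
    by (simp only: sum_divide_distrib lessThan_Suc_atMost)
  also have "\<dots> = (2 ^ Suc k - 1) / (2 * 2 ^ k)"
    using geometric_sum[of "2::real" "Suc k"] by simp
  also have "\<dots> \<le> 1" by simp
  finally show ?thesis .
qed simp

text \<open>Over the \<open>L\<close> scales together, each set costs at most 32 for absorption and
  1 for hits; some scale costs at most the average.\<close>

lemma exists_scale_rarely_hit:
  fixes F :: "'a set set" and L :: nat
  assumes "finite V" "F \<subseteq> Pow V" "V \<in> F" "L > 0"
    and small: "2 ^ L * (33 * real (card F) / L) < card V"
  shows "\<exists>i<L. exp (- (33 * real (card F) / L))
    \<le> bexp (1 / 2 ^ Suc i) V (\<lambda>X. of_bool (X \<noteq> {} \<and> (\<forall>S\<in>F. card (X \<inter> S) \<noteq> 1)))"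
proof -
  have finF: "finite F" using assms by (auto intro: finite_subset)
  obtain G where G: "\<And>i. G i \<subseteq> F" "\<And>i. G i \<subseteq> G (Suc i)"
    "\<And>i S. S \<in> F - G i \<Longrightarrow> 16 * 2 ^ i < card (S - \<Union>(G i))"
    "\<And>k. (\<Sum>i\<le>k. card (\<Union>(G i)) / 2 ^ i) \<le> 32 * real (card F)"
    using absorb_chain[OF finF] by blast
  define U where "U i = \<Union>(G i)" for i
  define \<rho> where "\<rho> i S = real (card (S - U i)) - 1" for i S
  \<comment> \<open>With \<open>p = 1 / 2 ^ Suc i\<close>, avoiding \<open>U i\<close> costs
    \<open>2 * p\<close> per element and hitting a residual set twice costs
    \<open>4 / (p * \<rho> i S)\<close>.\<close>
  define cost where "cost i = card (U i) / 2 ^ i + (\<Sum>S\<in>F - G i. 8 * 2 ^ i / \<rho> i S)" for i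
  have finS: "finite S" if "S \<in> F" for S
    using that assms by (auto intro: finite_subset)
  have monoG: "G i \<subseteq> G j" if "i \<le> j" for i j
    using lift_Suc_mono_le[of G, OF G(2) that] .
  have \<rho>_ge: "16 * 2 ^ i \<le> \<rho> i S" if "S \<in> F - G i" for i S
  proof -
    have "16 * 2 ^ i + 1 \<le> card (S - U i)"
      using G(3)[OF that] by (simp add: U_def)
    then have "real (16 * 2 ^ i + 1) \<le> real (card (S - U i))"
      by (rule of_nat_mono)
    then show ?thesis by (simp add: \<rho>_def)
  qed
  have \<rho>_anti: "\<rho> j S \<le> \<rho> i S" if "i \<le> j" "S \<in> F" for i j S
  proof -
    have "S - U j \<subseteq> S - U i"
      using monoG[OF that(1)] by (auto simp: U_def)
    then have "card (S - U j) \<le> card (S - U i)"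
      using finS[OF that(2)] by (intro card_mono) auto
    then show ?thesis by (simp add: \<rho>_def)
  qed
  \<comment> \<open>Exchange the sums to collect the hit costs set by set.\<close>
  have "(\<Sum>i<L. \<Sum>S\<in>F - G i. 8 * 2 ^ i / \<rho> i S)
      = (\<Sum>i<L. \<Sum>S | S \<in> F \<and> S \<notin> G i. 8 * 2 ^ i / \<rho> i S)"
    by (intro sum.cong) auto
  also have "\<dots> = (\<Sum>S\<in>F. \<Sum>i | i \<in> {..<L} \<and> S \<notin> G i. 8 * 2 ^ i / \<rho> i S)"
    using finF by (intro sum.swap_restrict) auto
  also have "\<dots> \<le> (\<Sum>S\<in>F. 1)"
    by (intro sum_mono sum_hit_cost_le) (auto intro: \<rho>_ge \<rho>_anti)
  finally have hit: "(\<Sum>i<L. \<Sum>S\<in>F - G i. 8 * 2 ^ i / \<rho> i S) \<le> card F" by simp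
  have "(\<Sum>i<L. card (U i) / 2 ^ i) \<le> 32 * real (card F)"
    using G(4)[of "L - 1"] \<open>L > 0\<close> lessThan_Suc_atMost[of "L - 1"] by (simp add: U_def)
  with hit have "(\<Sum>i<L. cost i) \<le> 33 * real (card F)"
    by (simp add: cost_def sum.distrib)
  also have "\<dots> = (\<Sum>i<L. 33 * real (card F) / L)"
    using \<open>L > 0\<close> by simp
  finally have "\<exists>i<L. cost i \<le> 33 * real (card F) / L"
    using \<open>L > 0\<close> sum_strict_mono[of "{..<L}" "\<lambda>_. 33 * real (card F) / L" cost]
    by (force simp: not_le)
  then obtain i where i: "i < L" "cost i \<le> 33 * real (card F) / L" by blast
  define p :: real where "p = 1 / 2 ^ Suc i"
  have p: "0 < p" "p \<le> 1 / 2" by (auto simp: p_def field_simps)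
  have Usub: "U i \<subseteq> V" using G(1) assms by (auto simp: U_def)
  \<comment> \<open>Otherwise \<open>U i = V\<close>, and by \<open>small\<close> the term
    \<open>card V / 2 ^ i\<close> alone exceeds the cost bound. So \<open>V\<close> itself must be
    hit twice, which makes the random set non-empty.\<close>
  have "V \<notin> G i"
  proof
    assume "V \<in> G i"
    then have "U i = V" using Usub by (auto simp: U_def)
    then have "card V / 2 ^ i \<le> cost i"
      using \<rho>_ge by (auto simp: cost_def intro!: sum_nonneg divide_nonneg_nonneg order_trans[OF _ \<rho>_ge])
    then have "card V / 2 ^ i \<le> 33 * real (card F) / L" using i by linarith
    then have "card V \<le> 2 ^ i * (33 * real (card F) / L)"
      by (simp add: field_simps)
    also have "\<dots> \<le> 2 ^ L * (33 * real (card F) / L)"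
      using i by (intro mult_right_mono power_increasing) auto
    finally show False using small by simp
  qed
  have "exp (- (33 * real (card F) / L)) \<le> exp (- cost i)"
    using i by simp
  also have "\<dots> = exp (- 2 * p) ^ card (U i) * (\<Prod>S\<in>F - G i. exp (- 4 / (p * \<rho> i S)))"
  proof -
    have "- cost i = card (U i) * (- 2 * p) + (\<Sum>S\<in>F - G i. - 4 / (p * \<rho> i S))"
      by (simp add: cost_def p_def sum_negf)
    then show ?thesis
      using finF by (simp only: exp_add exp_of_nat_mult exp_sum finite_Diff)
  qed
  also have "\<dots> \<le> (1 - p) ^ card (U i)
      * (\<Prod>S\<in>F - G i. bexp p (V - U i) (\<lambda>X. of_bool (2 \<le> card (X \<inter> (S - U i)))))"
  proof (intro mult_mono prod_mono power_mono conjI prod_nonneg)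
    show "exp (- 2 * p) \<le> 1 - p" using p by (intro exp_le_one_minus) auto
    fix S assume S: "S \<in> F - G i"
    have "p * (16 * 2 ^ i) \<le> p * \<rho> i S"
      using \<rho>_ge[OF S] p by (intro mult_left_mono) auto
    then have "4 \<le> p * \<rho> i S" by (simp add: p_def)
    then show "exp (- 4 / (p * \<rho> i S))
        \<le> bexp p (V - U i) (\<lambda>X. of_bool (2 \<le> card (X \<inter> (S - U i))))"
      unfolding \<rho>_def using S assms p by (intro bexp_two_hits) auto
  qed (use p in auto)
  also have "\<dots> \<le> (1 - p) ^ card (U i)
      * bexp p (V - U i) (\<lambda>X. \<Prod>S\<in>F - G i. of_bool (2 \<le> card (X \<inter> (S - U i))))"
  proof (intro mult_left_mono bexp_Harris_prod)
    fix S assume "S \<in> F - G i"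
    then have fin: "finite (S - U i)" using finS by auto
    show "mono (\<lambda>X. of_bool (2 \<le> card (X \<inter> (S - U i))) :: real)"
    proof (rule monoI)
      fix X Y :: "'a set" assume "X \<subseteq> Y"
      then have "card (X \<inter> (S - U i)) \<le> card (Y \<inter> (S - U i))"
        using fin by (intro card_mono) auto
      then show "of_bool (2 \<le> card (X \<inter> (S - U i))) \<le> (of_bool (2 \<le> card (Y \<inter> (S - U i))) :: real)"
        by auto
    qed
  qed (use finF assms p in auto)
  also have "\<dots> \<le> (1 - p) ^ card (U i)
      * bexp p (V - U i) (\<lambda>X. of_bool (X \<noteq> {} \<and> (\<forall>S\<in>F. card (X \<inter> S) \<noteq> 1)))"
  \<comment> \<open>As \<open>X\<close> misses \<open>U i\<close>, it is disjoint from absorbed sets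
    and meets every other set of \<open>F\<close> only in its residual part.\<close>
  proof (intro mult_left_mono bexp_mono)
    fix X assume X: "X \<subseteq> V - U i"
    have "X \<noteq> {} \<and> (\<forall>S\<in>F. card (X \<inter> S) \<noteq> 1)"
      if h: "\<forall>S\<in>F - G i. 2 \<le> card (X \<inter> (S - U i))"
    proof
      show "X \<noteq> {}" using h \<open>V \<in> F\<close> \<open>V \<notin> G i\<close> by force
      show "\<forall>S\<in>F. card (X \<inter> S) \<noteq> 1"
      proof
        fix S assume S: "S \<in> F"
        show "card (X \<inter> S) \<noteq> 1"
        proof (cases "S \<in> G i")
          case True
          then have "X \<inter> S = {}" using X by (auto simp: U_def)
          then show ?thesis by simp
        next
          case False
          then have "2 \<le> card (X \<inter> (S - U i))" using h S by auto
          moreover have "X \<inter> (S - U i) = X \<inter> S" using X by auto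
          ultimately show ?thesis by auto
        qed
      qed
    qed
    moreover have "(\<Prod>S\<in>F - G i. of_bool (2 \<le> card (X \<inter> (S - U i)))) = (0 :: real)"
      if "\<not> (\<forall>S\<in>F - G i. 2 \<le> card (X \<inter> (S - U i)))"
      using that finF by (intro prod_zero) auto
    ultimately show "(\<Prod>S\<in>F - G i. of_bool (2 \<le> card (X \<inter> (S - U i))))
        \<le> (of_bool (X \<noteq> {} \<and> (\<forall>S\<in>F. card (X \<inter> S) \<noteq> 1)) :: real)"
      by (cases "\<forall>S\<in>F - G i. 2 \<le> card (X \<inter> (S - U i))") auto
  qed (use p in auto)
  also have "\<dots> \<le> bexp p V (\<lambda>X. of_bool (X \<noteq> {} \<and> (\<forall>S\<in>F. card (X \<inter> S) \<noteq> 1)))"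
    using assms Usub p by (intro bexp_avoid) auto
  finally show ?thesis using i by (auto simp: p_def)
qed

section \<open>Runs before the first lone broadcast\<close>

text \<open>Determined by the seeds alone, whatever set is activated; hence the bound for fixed
  families applies seed by seed.\<close>

definition silent_transmitters :: "('r, 'm) algorithm \<Rightarrow> nat \<Rightarrow> (nat \<Rightarrow> 'r) \<Rightarrow> nat \<Rightarrow> nat set" where
  "silent_transmitters A n \<omega> t = {u \<in> {1..n}. act A n u (\<omega> u) (replicate t None) \<noteq> Listen}"

lemma broadcasts_alone_silent:
  assumes "W \<subseteq> {1..n}" "history A n W \<omega> t = (\<lambda>u. replicate t None)"
  shows "broadcasts_alone A n W \<omega> t \<longleftrightarrow> card (W \<inter> silent_transmitters A n \<omega> t) = 1"
proof -
  have "{u. u \<in> W \<and> round_actions A n W \<omega> (history A n W \<omega> t) u \<noteq> Listen}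
      = W \<inter> silent_transmitters A n \<omega> t"
    using assms by (auto simp: round_actions_def silent_transmitters_def)
  moreover have "(\<exists>!u. P u) \<longleftrightarrow> card (Collect P) = 1" for P :: "nat \<Rightarrow> bool"
    by (auto simp: card_1_singleton_iff set_eq_iff)
  ultimately show ?thesis by (simp add: broadcasts_alone_def)
qed

text \<open>A reception at \<open>u\<close> means that \<open>u\<close> listens and exactly one
  other node transmits, which is a lone broadcast.\<close>

lemma reception_eq_None:
  assumes "W \<subseteq> {1..n}" "\<not> broadcasts_alone A n W \<omega> t"
  shows "reception n (round_actions A n W \<omega> (history A n W \<omega> t)) u = None"
proof -
  let ?a = "round_actions A n W \<omega> (history A n W \<omega> t)"
  have inW: "w \<in> W" if "?a w \<noteq> Listen" for w
    using that by (auto simp: round_actions_def split: if_splits)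
  have "\<not> receives_from n ?a u v m" for v m
  proof
    assume r: "receives_from n ?a u v m"
    have "w = v" if w: "?a w \<noteq> Listen" for w
    proof -
      have "w \<noteq> u" using r w by (auto simp: receives_from_def)
      then have "w \<in> neighbors n u"
        using inW[OF w] assms(1) by (auto simp: neighbors_def)
      then show ?thesis using r w by (simp add: receives_from_def)
    qed
    moreover have "?a v \<noteq> Listen" using r by (simp add: receives_from_def)
    ultimately have "broadcasts_alone A n W \<omega> t"
      unfolding broadcasts_alone_def using inW by blast
    with assms(2) show False ..
  qed
  then show ?thesis by (simp add: reception_def)
qed

lemma history_silent:
  assumes "W \<subseteq> {1..n}" "\<forall>t<T. card (W \<inter> silent_transmitters A n \<omega> t) \<noteq> 1" "t \<le> T"
  shows "history A n W \<omega> t = (\<lambda>u. replicate t None)"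
  using assms(3)
proof (induction t)
  case (Suc t)
  then have h: "history A n W \<omega> t = (\<lambda>u. replicate t None)" by simp
  then have "\<not> broadcasts_alone A n W \<omega> t"
    using broadcasts_alone_silent[OF assms(1) h] assms(2) Suc.prems by auto
  then have "reception n (round_actions A n W \<omega> (\<lambda>u. replicate t None)) u = None" for u
    using reception_eq_None[OF assms(1), of A \<omega> t u] h by simp
  then show ?case
    using h by (simp add: replicate_append_same)
qed simp

lemma not_solved_if_silent:
  assumes "W \<subseteq> {1..n}" "\<forall>t<T. card (W \<inter> silent_transmitters A n \<omega> t) \<noteq> 1"
  shows "\<not> wakeup_solved_within A n W \<omega> T"
proof -
  have "\<not> broadcasts_alone A n W \<omega> t" if "t < T" for t
    using broadcasts_alone_silent[OF assms(1) history_silent[OF assms]] that assms(2) by auto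
  then show ?thesis by (auto simp: wakeup_solved_within_def)
qed

section \<open>Averaging over activated sets and asymptotics\<close>

text \<open>Double count the weight of the failing sets \<open>W\<close>, each weighted by the sum
  of its probabilities at all scales. For all seeds it is at least the left-hand side; its
  expectation is at most \<open>L / n\<close>, since the total weight is at most \<open>L\<close>
  and each \<open>W\<close> fails with probability at most \<open>1 / n\<close>.\<close>

lemma wakeup_round_bound:
  fixes A :: "('r, 'm::countable) algorithm"
  assumes A: "randomized_algorithm A" "solves_wakeup_whp A f"
    and n: "n \<ge> 2" and L: "L > 0"
    and small: "2 ^ L * (33 * (real (f n) + 1) / L) < n"
  shows "exp (- (33 * (real (f n) + 1) / L)) \<le> L / n"
proof -
  define T where "T = f n"
  define M where "M = PiM {1..n} (seed A n)"
  define B where "B W = {\<omega> \<in> space M. \<not> wakeup_solved_within A n W \<omega> T}" for W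
  define q where "q = exp (- (33 * (real T + 1) / L))"
  define p where "p i = (1 / 2 ^ Suc i :: real)" for i :: nat
  define w where "w i W = p i ^ card W * (1 - p i) ^ card ({1..n} - W)" for i and W :: "nat set"
  have p: "0 \<le> p i" "p i \<le> 1" for i
    unfolding p_def by (simp_all add: divide_le_eq del: power_Suc)
  have w0: "0 \<le> w i W" for i W using p by (simp add: w_def)
  interpret prob_space M
    unfolding M_def using A(1) by (intro prob_space_PiM) (auto simp: randomized_algorithm_def)
  have B: "B W \<in> events \<and> prob (B W) \<le> 1 / n" if W: "W \<subseteq> {1..n}" "W \<noteq> {}" for W
  proof -
    define C where "C = {\<omega> \<in> space M. wakeup_solved_within A n W \<omega> T}"
    have C: "prob C \<ge> 1 - 1 / n"
      using A(2) n W by (auto simp: solves_wakeup_whp_def C_def M_def T_def)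
    moreover have "1 - 1 / real n > 0" using n by simp
    \<comment> \<open>A set of positive measure is measurable, since \<^const>\<open>measure\<close> is \<open>0\<close> on non-measurable sets.\<close>
    ultimately have ev: "C \<in> events" using measure_notin_sets[of C M] by fastforce
    have "B W = space M - C" by (auto simp: B_def C_def)
    then show ?thesis using ev C prob_compl[OF ev] by auto
  qed
  define Ws where "Ws = Pow {1..n} - {{}}"
  have pointwise: "q \<le> (\<Sum>W\<in>Ws. (\<Sum>i<L. w i W) * indicator (B W) \<omega>)" if \<omega>: "\<omega> \<in> space M" for \<omega>
  proof -
    \<comment> \<open>Including the whole node set in the family forces the random set to be non-empty.\<close>
    define F where "F = insert {1..n} (silent_transmitters A n \<omega> ` {..<T})"
    have "card F \<le> Suc T"
      unfolding F_def using card_image_le[of "{..<T}" "silent_transmitters A n \<omega>"]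
      by (simp add: card_insert_if)
    then have c: "33 * real (card F) / L \<le> 33 * (real T + 1) / L"
      by (intro divide_right_mono) auto
    have "\<exists>i<L. exp (- (33 * real (card F) / L))
      \<le> bexp (1 / 2 ^ Suc i) {1..n} (\<lambda>X. of_bool (X \<noteq> {} \<and> (\<forall>S\<in>F. card (X \<inter> S) \<noteq> 1)))"
    proof (rule exists_scale_rarely_hit)
      have "2 ^ L * (33 * real (card F) / L) \<le> 2 ^ L * (33 * (real T + 1) / L)"
        using c by (intro mult_left_mono) auto
      then show "2 ^ L * (33 * real (card F) / L) < card {1..n}"
        using small by (simp add: T_def)
    qed (use L in \<open>auto simp: F_def silent_transmitters_def\<close>)
    then obtain i where i: "i < L" "exp (- (33 * real (card F) / L))
      \<le> bexp (p i) {1..n} (\<lambda>X. of_bool (X \<noteq> {} \<and> (\<forall>S\<in>F. card (X \<inter> S) \<noteq> 1)))"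
      by (auto simp: p_def)
    have "q \<le> exp (- (33 * real (card F) / L))" using c by (simp add: q_def)
    also note i(2)
    also have "bexp (p i) {1..n} (\<lambda>X. of_bool (X \<noteq> {} \<and> (\<forall>S\<in>F. card (X \<inter> S) \<noteq> 1)))
        = (\<Sum>X\<in>Ws. w i X * of_bool (X \<noteq> {} \<and> (\<forall>S\<in>F. card (X \<inter> S) \<noteq> 1)))"
      unfolding bexp_def w_def Ws_def by (intro sum.mono_neutral_right) auto
    \<comment> \<open>The good scale depends on the seeds; summing over all scales removes this
      dependence at the price of a factor \<open>L\<close>.\<close>
    also have "\<dots> \<le> (\<Sum>W\<in>Ws. (\<Sum>i<L. w i W) * indicator (B W) \<omega>)"
    proof (intro sum_mono mult_mono)
      fix X assume X: "X \<in> Ws"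
      show "w i X \<le> (\<Sum>i<L. w i X)"
        using i w0 by (intro member_le_sum) auto
      show "of_bool (X \<noteq> {} \<and> (\<forall>S\<in>F. card (X \<inter> S) \<noteq> 1)) \<le> (indicator (B X) \<omega> :: real)"
        using not_solved_if_silent[of X n T A \<omega>] X \<omega>
        by (auto simp: F_def B_def Ws_def indicator_def)
    qed (auto intro: sum_nonneg w0)
    finally show ?thesis .
  qed
  have "q = (\<integral>\<omega>. q \<partial>M)" by (simp add: prob_space)
  also have "\<dots> \<le> (\<integral>\<omega>. (\<Sum>W\<in>Ws. (\<Sum>i<L. w i W) * indicator (B W) \<omega>) \<partial>M)"
    using B pointwise
    by (intro integral_mono Bochner_Integration.integrable_sum integrable_mult_right)
      (auto simp: Ws_def less_top[symmetric])
  also have "\<dots> = (\<Sum>W\<in>Ws. (\<Sum>i<L. w i W) * prob (B W))"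
    using B by (subst Bochner_Integration.integral_sum) (auto simp: Ws_def less_top[symmetric])
  also have "\<dots> \<le> (\<Sum>W\<in>Ws. (\<Sum>i<L. w i W) * (1 / n))"
    using B by (intro sum_mono mult_left_mono sum_nonneg w0) (auto simp: Ws_def)
  \<comment> \<open>Adding the empty set back makes the weights of each scale sum to 1.\<close>
  also have "\<dots> \<le> (\<Sum>W\<in>Pow {1..n}. (\<Sum>i<L. w i W) * (1 / n))"
    unfolding Ws_def by (intro sum_mono2) (auto intro!: divide_nonneg_nonneg sum_nonneg w0)
  also have "\<dots> = (\<Sum>i<L. bexp (p i) {1..n} (\<lambda>_. 1)) / n"
    by (simp add: bexp_def w_def sum_divide_distrib[symmetric] sum.swap[of _ _ "{..<L}"])
  also have "\<dots> = L / n" by (simp add: bexp_const)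
  finally show ?thesis by (simp add: q_def T_def)
qed

theorem theorem5p1:
  fixes A :: "('r, 'm::countable) algorithm" and f :: "nat \<Rightarrow> nat"
  assumes "randomized_algorithm A"
    and "solves_wakeup_whp A f"
  shows "(\<lambda>n. real (f n)) \<in> \<Omega>(\<lambda>n. (log 2 (real n))\<^sup>2)"
proof (rule landau_omega.bigI)
  \<comment> \<open>\<open>1056 = 4 * 8 * 33\<close>: with \<open>L >= l / 8\<close>, a smaller
    \<open>f n\<close> gives \<open>K <= l / 4 + 264 / l\<close>.\<close>
  show "(0::real) < 1 / 1056" by simp
  \<comment> \<open>The first condition makes \<open>264 / l\<close> at most 1, the second closes
    the final contradiction, and the third yields the size hypothesis of
    \<open>wakeup_round_bound\<close>.\<close>
  have ev: "eventually (\<lambda>n. log 2 (real n) \<ge> 264) sequentially"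
    "eventually (\<lambda>n. exp 1 * log 2 (real n) < 2 powr (log 2 (real n) / 2)) sequentially"
    "eventually (\<lambda>n. log 2 (real n) / 4 + 1 < 2 powr (log 2 (real n) / 2)) sequentially"
    by real_asymp+
  show "eventually (\<lambda>n. norm (real (f n)) \<ge> 1 / 1056 * norm ((log 2 (real n))\<^sup>2)) sequentially"
    using ev eventually_ge_at_top[of 2]
  proof eventually_elim
    case (elim n)
    define l where "l = log 2 (real n)"
    define L where "L = nat \<lfloor>l / 4\<rfloor>"
    have l: "l \<ge> 264" "exp 1 * l < 2 powr (l / 2)" "l / 4 + 1 < 2 powr (l / 2)"
      using elim by (auto simp: l_def)
    have nl: "real n = 2 powr l" using elim by (simp add: l_def)
    have L: "real L \<le> l / 4" "real L \<ge> l / 8" "L > 0"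
      using l unfolding L_def by linarith+
    show ?case
    proof (rule ccontr)
      assume "\<not> ?case"
      then have fn: "real (f n) < l\<^sup>2 / 1056" by (simp add: l_def)
      define K where "K = 33 * (real (f n) + 1) / L"
      have "K \<le> 33 * (l\<^sup>2 / 1056 + 1) / (l / 8)"
        unfolding K_def using fn L l by (intro frac_le) auto
      also have "\<dots> = l / 4 + 264 / l"
        using l by (simp add: field_simps power2_eq_square)
      also have "\<dots> \<le> l / 4 + 1"
        using l by simp
      finally have K: "K \<le> l / 4 + 1" .
      have K0: "0 \<le> K" by (simp add: K_def)
      have "(2::real) ^ L = 2 powr real L" by (simp add: powr_realpow)
      also have "\<dots> \<le> 2 powr (l / 2)" using L l by (intro powr_mono) auto
      finally have "2 ^ L * K \<le> 2 powr (l / 2) * (l / 4 + 1)"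
        using K K0 by (intro mult_mono) auto
      also have "\<dots> < 2 powr (l / 2) * 2 powr (l / 2)"
        using l by (intro mult_strict_left_mono) auto
      also have "\<dots> = n" by (simp add: nl powr_add[symmetric])
      finally have "exp (- K) \<le> L / n"
        using wakeup_round_bound[OF assms, of n L] elim L by (simp add: K_def)
      then have "real n \<le> L * exp K"
        using elim by (simp add: exp_minus field_simps)
      also have "\<dots> \<le> l * exp (l / 4 + 1)"
        using K L l by (intro mult_mono) auto
      also have "\<dots> = exp 1 * l * exp (l / 4)" by (simp add: exp_add)
      also have "\<dots> \<le> exp 1 * l * 2 powr (l / 2)"
      proof (intro mult_left_mono)
        \<comment> \<open>\<open>exp 1 <= 4\<close> gives
          \<open>exp (l / 4) <= 4 powr (l / 4) = 2 powr (l / 2)\<close>.\<close>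
        have "exp (1::real) \<le> 4" using exp_le by linarith
        then have "1 \<le> ln (4::real)" by (simp add: ln_ge_iff)
        also have "ln (4::real) = 2 * ln 2" using ln_realpow[of 2 2] by simp
        finally have "l / 2 * (1 / 2) \<le> l / 2 * ln 2" using l by (intro mult_left_mono) auto
        then show "exp (l / 4) \<le> 2 powr (l / 2)" by (simp add: powr_def)
      qed (use l in auto)
      also have "\<dots> < 2 powr (l / 2) * 2 powr (l / 2)"
        using l by (intro mult_strict_right_mono) auto
      also have "\<dots> = n" by (simp add: nl powr_add[symmetric])
      finally show False by simp
    qed
  qed
qed

end
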